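(* Let $k>1$ be an integer and $n\ge0$. Then \[\sum_T v^{\,n-\mathrm{prop}\,T}\,u^{\,\mathrm{prop}\,T-\mathrm{comp}\,T}\,w^{\,\mathrm{comp}\,T}=P_n\bigl(kv,(k-1)u,w\bigr),\] where the sum is over all labeled $k$-ary trees $T$ with $n$ labeled vertices, labeled by $[n]$.
   Context: A $k$-ary tree is an ordered rooted tree (children of each vertex linearly ordered) in which every vertex has either $k$ children or $0$ children. A labeled $k$-ary tree on $[n]$ is a $k$-ary tree with exactly $n$ vertices having $k$ children, these vertices being labeled bijectively by $[n]$; the vertices with $0$ children (leaves) are unlabeled. A labeled vertex is proper if its label is less than the labels of all its labeled proper descendants; $\mathrm{prop}\,T$ is the number of proper vertices. The decomposing path of $T$ is the path from the root defined as follows: from a labeled vertex $x$ go to the first child of $x$, unless $x$ is improper and the smallest label among the descendants of $x$ belongs to a descendant of the first child of $x$, in which case go to the second child of $x$; stop upon reaching a leaf. $\mathrm{comp}\,T$ is the number of labeled vertices on the decomposing path. $P_n(a,b,c)=c\prod_{i=1}^{n-1}(ia+(n-i)b+c)$ for $n\ge1$, and $P_0=1$. *)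

theory Defs
  imports Main
begin

datatype ltree = Leaf | Node nat "ltree list"

primrec kary :: "nat \<Rightarrow> ltree \<Rightarrow> bool" where
  "kary k Leaf \<longleftrightarrow> True"
| "kary k (Node x ts) \<longleftrightarrow> length ts = k \<and> list_all (kary k) ts"

primrec labels :: "ltree \<Rightarrow> nat list" where
  "labels Leaf = []"
| "labels (Node x ts) = x # concat (map labels ts)"

definition labeled_trees :: "nat \<Rightarrow> nat \<Rightarrow> ltree set" where
  "labeled_trees k n = {T. kary k T \<and> distinct (labels T) \<and> set (labels T) = {1..n}}"

text \<open>The arguments are the label of a vertex and the list of subtrees at its children.\<close>

definition proper :: "nat \<Rightarrow> ltree list \<Rightarrow> bool" where
  "proper x ts \<longleftrightarrow> (\<forall>t \<in> set ts. \<forall>y \<in> set (labels t). x < y)"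

primrec prop_count :: "ltree \<Rightarrow> nat" where
  "prop_count Leaf = 0"
| "prop_count (Node x ts) = (if proper x ts then 1 else 0) + sum_list (map prop_count ts)"

text \<open>
  The decomposing path, given by the labels of its labeled vertices. A vertex counts as a
  descendant of itself. The third equation concerns only vertices with fewer than two children,
  which do not occur in \<open>k\<close>-ary trees with \<open>k > 1\<close>.
\<close>

fun decomposing_path :: "ltree \<Rightarrow> nat list" where
  "decomposing_path Leaf = []"
| "decomposing_path (Node x (t1 # t2 # ts)) =
     x # (if \<not> proper x (t1 # t2 # ts) \<and>
             Min (set (labels (Node x (t1 # t2 # ts)))) \<in> set (labels t1)
          then decomposing_path t2 else decomposing_path t1)"
| "decomposing_path (Node x _) = [x]"

definition comp_count :: "ltree \<Rightarrow> nat" where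
  "comp_count T = length (decomposing_path T)"

definition P :: "nat \<Rightarrow> 'a \<Rightarrow> 'a \<Rightarrow> 'a \<Rightarrow> 'a::comm_ring_1" where
  "P n a b c = (if n = 0 then 1
     else c * (\<Prod>i = 1..n - 1. of_nat i * a + of_nat (n - i) * b + c))"

text \<open>
  The next facts show that the sum over \<open>labeled_trees k n\<close> is a genuine finite sum, and that
  the truncated subtractions in the exponents \<open>n - prop_count T\<close> and
  \<open>prop_count T - comp_count T\<close> never actually truncate.
\<close>

lemma prop_count_le_length: "prop_count T \<le> length (labels T)"
proof (induction T)
  case (Node x ts)
  have "sum_list (map prop_count ts) \<le> sum_list (map (\<lambda>t. length (labels t)) ts)"
    using Node by (intro sum_list_mono) auto
  then show ?case by (simp add: length_concat o_def)
qed simp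

lemma prop_count_pos: "labels T \<noteq> [] \<Longrightarrow> distinct (labels T) \<Longrightarrow> prop_count T > 0"
proof (induction T)
  case (Node x ts)
  show ?case
  proof (cases "proper x ts")
    case False
    then obtain t where t: "t \<in> set ts" "labels t \<noteq> []" unfolding proper_def by force
    then have "distinct (labels t)" using Node.prems by (auto simp: distinct_concat_iff)
    then have "prop_count t > 0" using Node.IH t by blast
    moreover have "prop_count t \<le> sum_list (map prop_count ts)"
      using t by (intro member_le_sum_list) auto
    ultimately show ?thesis by simp
  qed simp
qed simp

lemma prop_count_le:
  assumes "T \<in> labeled_trees k n"
  shows "prop_count T \<le> n"
proof -
  have "length (labels T) = n"
    using assms distinct_card[of "labels T"] by (simp add: labeled_trees_def)
  then show ?thesis using prop_count_le_length[of T] by simp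
qed

lemma comp_count_le_prop_count_aux:
  "distinct (labels T) \<Longrightarrow> kary k T \<Longrightarrow> k > 1 \<Longrightarrow> length (decomposing_path T) \<le> prop_count T"
proof (induction T rule: decomposing_path.induct)
  case (2 x t1 t2 ts)
  let ?ts = "t1 # t2 # ts"
  let ?m = "Min (set (labels (Node x ?ts)))"
  have d: "distinct (labels t1)" "distinct (labels t2)" and kk: "kary k t1" "kary k t2"
    using "2.prems" by auto
  show ?case
  proof (cases "proper x ?ts")
    case True
    then show ?thesis using 2 d kk by auto
  next
    case False
    then obtain t y where ty: "t \<in> set ?ts" "y \<in> set (labels t)" "y \<le> x"
      unfolding proper_def by (meson not_less)
    have fin: "finite (set (labels (Node x ?ts)))" by simp
    have yin: "y \<in> set (labels (Node x ?ts))" using ty by auto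
    have "x \<noteq> y" using ty "2.prems"(1) by auto
    then have "?m < x" using Min_le[OF fin yin] ty(3) by linarith
    moreover have "?m \<in> set (labels (Node x ?ts))" using fin by (intro Min_in) auto
    ultimately have m: "?m \<in> (\<Union>t \<in> set ?ts. set (labels t))" by auto
    show ?thesis
    proof (cases "?m \<in> set (labels t1)")
      case True
      then have "labels t1 \<noteq> []" by auto
      then have "prop_count t1 > 0" using d prop_count_pos by blast
      moreover have "length (decomposing_path t2) \<le> prop_count t2"
        using 2(1) False True d kk "2.prems" by blast
      moreover have "decomposing_path (Node x ?ts) = x # decomposing_path t2"
        using False True by (simp del: labels.simps)
      ultimately show ?thesis using False by simp
    next
      case nt1: False
      then obtain t where t: "t \<in> set (t2 # ts)" "?m \<in> set (labels t)" using m by auto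
      have "distinct (labels t)" using t "2.prems"(1) by (auto simp: distinct_concat_iff)
      moreover have "labels t \<noteq> []" using t(2) by auto
      ultimately have "prop_count t > 0" using prop_count_pos by blast
      moreover have "prop_count t \<le> sum_list (map prop_count (t2 # ts))"
        using t(1) by (intro member_le_sum_list) auto
      moreover have "length (decomposing_path t1) \<le> prop_count t1"
        using 2(2) nt1 d kk "2.prems" by blast
      moreover have "decomposing_path (Node x ?ts) = x # decomposing_path t1"
        using False nt1 by (simp del: labels.simps)
      ultimately show ?thesis using False by simp
    qed
  qed
qed auto

lemma comp_count_le_prop_count:
  "k > 1 \<Longrightarrow> T \<in> labeled_trees k n \<Longrightarrow> comp_count T \<le> prop_count T"
  unfolding comp_count_def labeled_trees_def using comp_count_le_prop_count_aux by blast

lemma finite_kary_bounded: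
  "finite {T. kary k T \<and> length (labels T) \<le> m \<and> set (labels T) \<subseteq> {1..n}}" (is "finite (?A m)")
proof (induction m)
  case 0
  have "?A 0 \<subseteq> {Leaf}"
  proof
    fix T assume "T \<in> ?A 0"
    then show "T \<in> {Leaf}" by (cases T) auto
  qed
  then show ?case using finite_subset by blast
next
  case (Suc m)
  let ?B = "{ts. set ts \<subseteq> ?A m \<and> length ts = k}"
  have "?A (Suc m) \<subseteq> insert Leaf ((\<lambda>(x, ts). Node x ts) ` ({1..n} \<times> ?B))"
  proof
    fix T assume T: "T \<in> ?A (Suc m)"
    show "T \<in> insert Leaf ((\<lambda>(x, ts). Node x ts) ` ({1..n} \<times> ?B))"
    proof (cases T)
      case (Node x ts)
      have "t \<in> ?A m" if t: "t \<in> set ts" for t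
      proof -
        have "length (labels t) \<le> sum_list (map (\<lambda>t. length (labels t)) ts)"
          using t by (intro member_le_sum_list) auto
        also have "\<dots> \<le> m" using T Node by (simp add: length_concat o_def)
        finally show ?thesis using T Node t by (auto simp: list_all_iff)
      qed
      then show ?thesis using T Node by force
    qed simp
  qed
  moreover have "finite ?B" using Suc by (rule finite_lists_length_eq)
  ultimately show ?case by (meson finite_SigmaI finite_atLeastAtMost finite_imageI
        finite.insertI finite_subset)
qed

lemma finite_labeled_trees: "finite (labeled_trees k n)"
proof (rule finite_subset[OF _ finite_kary_bounded[of k n n]])
  show "labeled_trees k n \<subseteq> {T. kary k T \<and> length (labels T) \<le> n \<and> set (labels T) \<subseteq> {1..n}}"
    using distinct_card by (fastforce simp: labeled_trees_def)
qed

end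

theory Submission
  imports Defs
begin

text \<open>
  Let \<open>C\<^sub>w\<close> be the exponential generating function of the weighted trees and \<open>A = C\<^sub>u\<close>, so that
  \<open>A\<close> ignores the decomposing path. Look at the vertex with the smallest label. If it is the root,
  the root is proper and the path continues into the first subtree. Otherwise the root is improper
  and the path continues into a subtree that does not contain the smallest label. This gives
  \<open>C\<^sub>w' = w C\<^sub>w A\<^bsup>k-1\<^esup> + k v w x C\<^sub>w A\<^bsup>k-2\<^esup> A' / u\<close>, whence \<open>C\<^sub>w = A\<^bsup>w/u\<^esup>\<close>
  and the coefficients of \<open>C\<^sub>w\<close> are of binomial type in \<open>w\<close>.
  Everything is carried out without division, with sums over subsets of a label set in place
  of products of generating functions, and with \<open>P (Suc n) a b c / c\<close> in the role of \<open>C\<^sub>w' / w\<close>.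
\<close>

section \<open>Convolution identities for the polynomials \<open>P\<close>\<close>

definition P_quot :: "nat \<Rightarrow> 'a \<Rightarrow> 'a \<Rightarrow> 'a \<Rightarrow> 'a::comm_ring_1" where
  "P_quot n a b c = (\<Prod>i = 1..n. of_nat i * a + of_nat (Suc n - i) * b + c)"

lemma P_0 [simp]: "P 0 a b c = 1"
  by (simp add: P_def)

lemma P_Suc: "P (Suc n) a b c = c * P_quot n a b c"
  by (simp add: P_def P_quot_def)

text \<open>The factor with \<open>i = n\<close> is \<open>(c + b) + of_nat n * a\<close>. In the
  others one \<open>b\<close> moves into \<open>c\<close>, leaving
  \<open>P_quot (n - 1) a b (c + b)\<close>; for \<open>n = 0\<close> the second summand vanishes.
  This recursion drives the convolution identities, and the decomposition of trees at the smallest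
  label has the same shape.\<close>

lemma P_quot_rec:
  "P_quot n a b c = P n a b (c + b) + of_nat n * a * P_quot (n - 1) a b (c + b)"
proof (cases n)
  case 0
  then show ?thesis by (simp add: P_quot_def)
next
  case (Suc m)
  have "P_quot (Suc m) a b c = (of_nat (Suc m) * a + b + c) *
      (\<Prod>i = 1..m. of_nat i * a + of_nat (Suc (Suc m) - i) * b + c)"
    by (simp add: P_quot_def mult.commute)
  also have "(\<Prod>i = 1..m. of_nat i * a + of_nat (Suc (Suc m) - i) * b + c) = P_quot m a b (c + b)"
    unfolding P_quot_def by (intro prod.cong) (auto simp: Suc_diff_le algebra_simps)
  finally show ?thesis
    by (simp add: Suc P_Suc algebra_simps)
qed

lemma sum_Pow_insert:
  assumes "finite S" "x \<notin> S"
  shows "sum f (Pow (insert x S)) = sum f (Pow S) + (\<Sum>A\<in>Pow S. f (insert x A))"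
proof -
  have "inj_on (insert x) (Pow S)" "Pow S \<inter> insert x ` Pow S = {}"
    using assms by (auto simp: inj_on_def)
  then show ?thesis
    using assms by (simp add: Pow_insert sum.union_disjoint sum.reindex)
qed

lemma sum_Pow_swap:
  assumes "finite S"
  shows "(\<Sum>A\<in>Pow S. f A (S - A)) = (\<Sum>A\<in>Pow S. f (S - A) A)"
  by (rule sum.reindex_bij_witness[of _ "\<lambda>A. S - A" "\<lambda>A. S - A"])
     (auto simp: double_diff)

text \<open>\<open>P_quot_rec\<close> splits the second factor. One part is the convolution
  \<open>PP\<close> with \<open>c\<close> shifted by \<open>b\<close>. In the other, the factor
  \<open>card (S - A)\<close> counts the points \<open>y\<close> of \<open>S - A\<close>; deleting
  \<open>y\<close> and exchanging the sums leaves convolutions over \<open>S - {y}\<close>, given by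
  \<open>PQ\<close>.\<close>

lemma sum_Pow_P_quot_step:
  fixes a b c d :: "'a::comm_ring_1"
  assumes S: "finite S" "card S = n"
    and PP: "(\<Sum>A\<in>Pow S. P (card A) a b d * P (card (S - A)) a b (c + b)) = P n a b (d + (c + b))"
    and PQ: "\<And>y. y \<in> S \<Longrightarrow>
      (\<Sum>A\<in>Pow (S - {y}). P (card A) a b d * P_quot (card (S - {y} - A)) a b (c + b))
        = P_quot (n - 1) a b (d + (c + b))"
  shows "(\<Sum>A\<in>Pow S. P (card A) a b d * P_quot (card (S - A)) a b c) = P_quot n a b (d + c)"
proof -
  have "(\<Sum>A\<in>Pow S. P (card A) a b d * (of_nat (card (S - A)) * P_quot (card (S - A) - 1) a b (c + b)))
      = (\<Sum>A\<in>Pow S. \<Sum>y\<in>{y\<in>S. y \<notin> A}. P (card A) a b d * P_quot (card (S - {y} - A)) a b (c + b))"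
  proof (intro sum.cong refl)
    fix A assume "A \<in> Pow S"
    have "card (S - {y} - A) = card (S - A) - 1" if "y \<in> {y\<in>S. y \<notin> A}" for y
    proof -
      have "S - {y} - A = (S - A) - {y}" by auto
      then show ?thesis using that S by simp
    qed
    moreover have "{y\<in>S. y \<notin> A} = S - A" by auto
    ultimately show "P (card A) a b d * (of_nat (card (S - A)) * P_quot (card (S - A) - 1) a b (c + b))
      = (\<Sum>y\<in>{y\<in>S. y \<notin> A}. P (card A) a b d * P_quot (card (S - {y} - A)) a b (c + b))"
      by (simp add: mult.left_commute)
  qed
  also have "\<dots> = (\<Sum>y\<in>S. \<Sum>A\<in>{A\<in>Pow S. y \<notin> A}.
      P (card A) a b d * P_quot (card (S - {y} - A)) a b (c + b))"
    using S by (intro sum.swap_restrict) auto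
  also have "\<dots> = (\<Sum>y\<in>S. P_quot (n - 1) a b (d + (c + b)))"
  proof (intro sum.cong refl)
    fix y assume "y \<in> S"
    moreover have "{A\<in>Pow S. y \<notin> A} = Pow (S - {y})" by auto
    ultimately show "(\<Sum>A\<in>{A\<in>Pow S. y \<notin> A}. P (card A) a b d * P_quot (card (S - {y} - A)) a b (c + b))
      = P_quot (n - 1) a b (d + (c + b))"
      using PQ by simp
  qed
  finally have Q: "(\<Sum>A\<in>Pow S. P (card A) a b d *
      (of_nat (card (S - A)) * P_quot (card (S - A) - 1) a b (c + b)))
      = of_nat n * P_quot (n - 1) a b (d + (c + b))"
    using S by simp
  have "(\<Sum>A\<in>Pow S. P (card A) a b d * P_quot (card (S - A)) a b c)
      = (\<Sum>A\<in>Pow S. P (card A) a b d * P (card (S - A)) a b (c + b)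
          + a * (P (card A) a b d * (of_nat (card (S - A)) * P_quot (card (S - A) - 1) a b (c + b))))"
    by (intro sum.cong refl, subst P_quot_rec) (simp add: algebra_simps)
  also have "\<dots> = P n a b (d + (c + b)) + a * (of_nat n * P_quot (n - 1) a b (d + (c + b)))"
    unfolding sum.distrib sum_distrib_left[symmetric] PP Q ..
  also have "\<dots> = P_quot n a b (d + c)"
    by (subst P_quot_rec) (simp add: algebra_simps)
  finally show ?thesis .
qed

text \<open>This is the binomial-type property of \<open>P\<close>, the counterpart of multiplying
  powers of one series. The identities are proved together: the first at size \<open>Suc n\<close>
  follows from the second at size \<open>n\<close>, and the second at size \<open>Suc n\<close> from
  the first at that size and itself at size \<open>n\<close>.\<close>

lemma sum_Pow_P:
  fixes a b c d :: "'a::comm_ring_1"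
  assumes "finite S"
  shows "(\<Sum>A\<in>Pow S. P (card A) a b d * P (card (S - A)) a b c) = P (card S) a b (d + c)"
    and "(\<Sum>A\<in>Pow S. P (card A) a b d * P_quot (card (S - A)) a b c) = P_quot (card S) a b (d + c)"
  using assms
proof (induction "card S" arbitrary: S c d)
  case 0
  { case 1 then show ?case using 0 by simp
  next
    case 2 then show ?case using 0 by (simp add: P_quot_def) }
next
  case (Suc n)
  \<comment> \<open>Both parameters stay general because the second identity uses this one with
    \<open>c + b\<close> in place of \<open>c\<close>.\<close>
  have PP: "(\<Sum>A\<in>Pow S. P (card A) a b d * P (card (S - A)) a b c) = P (card S) a b (d + c)"
    if fin: "finite S" for c d
  proof -
    \<comment> \<open>The block that contains \<open>x\<close> is nonempty, so \<open>P_Suc\<close>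
      extracts its parameter, \<open>c\<close> or \<open>d\<close>. The two resulting sums carry the
      same \<open>P_quot\<close> value, and the coefficients add up to \<open>d + c\<close>.\<close>
    obtain x B where x: "S = insert x B" "x \<notin> B" "card B = n"
      using Suc(3) by (metis card_Suc_eq)
    then have B: "finite B" using fin by simp
    have *: "card (insert x B - A) = Suc (card (B - A))" "card (insert x A) = Suc (card A)"
      "B - insert x A = B - A" if "A \<in> Pow B" for A
    proof -
      have "insert x B - A = insert x (B - A)" "x \<notin> A" "finite A"
        using that x B finite_subset by auto
      then show "card (insert x B - A) = Suc (card (B - A))" "card (insert x A) = Suc (card A)"
        "B - insert x A = B - A"
        using x B by auto
    qed
    have "(\<Sum>A\<in>Pow S. P (card A) a b d * P (card (S - A)) a b c)
      = (\<Sum>A\<in>Pow B. c * (P (card A) a b d * P_quot (card (B - A)) a b c))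
        + (\<Sum>A\<in>Pow B. d * (P (card (B - A)) a b c * P_quot (card A) a b d))"
      unfolding x(1) sum_Pow_insert[OF B x(2)]
      by (intro arg_cong2[where f = "(+)"] sum.cong refl)
         (simp_all add: * P_Suc mult_ac)
    also have "(\<Sum>A\<in>Pow B. d * (P (card (B - A)) a b c * P_quot (card A) a b d))
      = (\<Sum>A\<in>Pow B. d * (P (card A) a b c * P_quot (card (B - A)) a b d))"
      by (rule sum_Pow_swap[OF B, symmetric])
    also have "(\<Sum>A\<in>Pow B. c * (P (card A) a b d * P_quot (card (B - A)) a b c)) +
      (\<Sum>A\<in>Pow B. d * (P (card A) a b c * P_quot (card (B - A)) a b d))
      = c * P_quot n a b (d + c) + d * P_quot n a b (c + d)"
      using Suc(2)[of B] B x by (simp flip: sum_distrib_left)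
    also have "\<dots> = P (card S) a b (d + c)"
      by (simp add: P_Suc algebra_simps flip: Suc(3))
    finally show ?thesis .
  qed
  { case 1 then show ?case using PP by blast
  next
    case 2
    show ?case
    proof (rule sum_Pow_P_quot_step[OF 2 refl PP[OF 2]])
      fix y assume "y \<in> S"
      then have y: "n = card (S - {y})" "card S - 1 = card (S - {y})"
        using Suc(3)[symmetric] 2 by simp_all
      show "(\<Sum>A\<in>Pow (S - {y}). P (card A) a b d * P_quot (card (S - {y} - A)) a b (c + b))
        = P_quot (card S - 1) a b (d + (c + b))"
        unfolding y(2) using 2 by (intro Suc(2) y) simp
    qed }
qed

text \<open>Deleting \<open>m\<close> from its block reduces both sums to convolutions over
  \<open>S - {m}\<close>. On the level of generating functions, marking \<open>m\<close>
  differentiates the factor whose block contains it.\<close>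

lemma sum_Pow_mem_P:
  fixes a b c d :: "'a::comm_ring_1"
  assumes "finite S" "m \<in> S"
  shows "(\<Sum>A\<in>{A\<in>Pow S. m \<in> A}. P_quot (card A - 1) a b c * P (card (S - A)) a b d)
      = P_quot (card S - 1) a b (c + d)"
    and "(\<Sum>A\<in>{A\<in>Pow S. m \<notin> A}. P (card A) a b d * P_quot (card (S - A) - 1) a b c)
      = P_quot (card S - 1) a b (d + c)"
proof -
  have eq: "card (S - A) - 1 = card (S - {m} - A)" if "m \<notin> A" for A
  proof -
    have "S - {m} - A = (S - A) - {m}" by auto
    then show ?thesis using assms that by simp
  qed
  have *: "{A\<in>Pow S. m \<notin> A} = Pow (S - {m})" by auto
  have "(\<Sum>A\<in>{A\<in>Pow S. m \<notin> A}. P (card A) a b d * P_quot (card (S - A) - 1) a b c)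
      = (\<Sum>A\<in>Pow (S - {m}). P (card A) a b d * P_quot (card (S - {m} - A)) a b c)"
    by (rule sum.cong[OF *], subst eq) auto
  then show 2: "(\<Sum>A\<in>{A\<in>Pow S. m \<notin> A}. P (card A) a b d * P_quot (card (S - A) - 1) a b c)
      = P_quot (card S - 1) a b (d + c)"
    using sum_Pow_P(2)[of "S - {m}" a b d c] assms by simp
  have "(\<Sum>A\<in>{A\<in>Pow S. m \<in> A}. P_quot (card A - 1) a b c * P (card (S - A)) a b d)
    = (\<Sum>A\<in>{A\<in>Pow S. m \<notin> A}. P (card A) a b d * P_quot (card (S - A) - 1) a b c)"
    by (rule sum.reindex_bij_witness[of _ "\<lambda>A. S - A" "\<lambda>A. S - A"])
       (use assms in \<open>auto simp: double_diff mult.commute\<close>)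
  then show "(\<Sum>A\<in>{A\<in>Pow S. m \<in> A}. P_quot (card A - 1) a b c * P (card (S - A)) a b d)
      = P_quot (card S - 1) a b (c + d)"
    using 2 by (simp add: add.commute)
qed

section \<open>Trees and forests with a given label set\<close>

definition trees_on :: "nat \<Rightarrow> nat set \<Rightarrow> ltree set" where
  "trees_on k S = {T. kary k T \<and> distinct (labels T) \<and> set (labels T) = S}"

text \<open>The number \<open>j\<close> of trees is independent of the arity \<open>k\<close>, so
  that the subtrees at a vertex can be split off one at a time.\<close>

definition forests_on :: "nat \<Rightarrow> nat \<Rightarrow> nat set \<Rightarrow> ltree list set" where
  "forests_on k j S = {ts. length ts = j \<and> list_all (kary k) ts \<and>
     distinct (concat (map labels ts)) \<and> set (concat (map labels ts)) = S}"

lemma trees_on_empty [simp]: "trees_on k {} = {Leaf}"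
proof -
  have "T = Leaf" if "labels T = []" for T using that by (cases T) auto
  then show ?thesis by (auto simp: trees_on_def)
qed

lemma trees_on_nonempty:
  assumes "S \<noteq> {}"
  shows "trees_on k S = (\<Union>x\<in>S. Node x ` forests_on k k (S - {x}))"
proof (intro set_eqI)
  fix T
  show "T \<in> trees_on k S \<longleftrightarrow> T \<in> (\<Union>x\<in>S. Node x ` forests_on k k (S - {x}))"
    using assms by (cases T) (auto simp: trees_on_def forests_on_def)
qed

lemma forests_on_0: "forests_on k 0 S = (if S = {} then {[]} else {})"
  by (auto simp: forests_on_def)

lemma forests_on_Suc:
  "forests_on k (Suc j) S =
    (\<lambda>(A, t, ts). t # ts) ` (SIGMA A:Pow S. trees_on k A \<times> forests_on k j (S - A))"
proof (intro equalityI subsetI)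
  fix l assume "l \<in> forests_on k (Suc j) S"
  then obtain t ts where l: "l = t # ts"
    and "t \<in> trees_on k (set (labels t))" "set (labels t) \<subseteq> S"
      "ts \<in> forests_on k j (S - set (labels t))"
    unfolding forests_on_def trees_on_def by (cases l) auto
  then have "(set (labels t), t, ts) \<in> (SIGMA A:Pow S. trees_on k A \<times> forests_on k j (S - A))"
    by auto
  then show "l \<in> (\<lambda>(A, t, ts). t # ts) ` (SIGMA A:Pow S. trees_on k A \<times> forests_on k j (S - A))"
    unfolding l by (rule rev_image_eqI) simp
qed (auto simp: forests_on_def trees_on_def, blast+)

lemma subset_DiffD: "A \<subseteq> B - C \<Longrightarrow> A \<subseteq> B"
  by blast

lemma finite_forests_on:
  assumes "finite S" "\<And>A. A \<subseteq> S \<Longrightarrow> finite (trees_on k A)"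
  shows "finite (forests_on k j S)"
  using assms
proof (induction j arbitrary: S)
  case (Suc j)
  show ?case
    unfolding forests_on_Suc using Suc by (intro finite_imageI finite_SigmaI) (auto dest!: subset_DiffD)
qed (simp add: forests_on_0)

lemma finite_trees_on: "finite S \<Longrightarrow> finite (trees_on k S)"
proof (induction "card S" arbitrary: S rule: less_induct)
  case less
  show ?case
  proof (cases "S = {}")
    case False
    have "finite (forests_on k k (S - {x}))" if "x \<in> S" for x
    proof (rule finite_forests_on)
      fix A assume "A \<subseteq> S - {x}"
      then have "A \<subset> S" using that by auto
      then show "finite (trees_on k A)"
        using less psubset_card_mono finite_subset by (metis psubsetE)
    qed (use less in simp)
    then show ?thesis using less by (simp add: trees_on_nonempty[OF False])
  qed simp
qed

section \<open>Sums over trees and forests as subset convolutions\<close>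

lemma sum_trees_on:
  assumes "finite S" "S \<noteq> {}"
  shows "sum f (trees_on k S) = (\<Sum>x\<in>S. \<Sum>ts\<in>forests_on k k (S - {x}). f (Node x ts))"
proof -
  have "sum f (trees_on k S) = (\<Sum>x\<in>S. sum f (Node x ` forests_on k k (S - {x})))"
    unfolding trees_on_nonempty[OF assms(2)] using assms
    by (intro sum.UNION_disjoint ballI impI)
       (auto intro!: finite_forests_on finite_trees_on intro: finite_subset)
  also have "\<dots> = (\<Sum>x\<in>S. \<Sum>ts\<in>forests_on k k (S - {x}). f (Node x ts))"
    by (intro sum.cong refl) (auto simp: sum.reindex inj_on_def)
  finally show ?thesis .
qed

text \<open>The label set \<open>A\<close> of the first tree is determined by that tree, so no
  forest is counted twice.\<close>

lemma sum_forests_on_Suc: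
  assumes "finite S"
  shows "sum f (forests_on k (Suc j) S)
    = (\<Sum>A\<in>Pow S. \<Sum>t\<in>trees_on k A. \<Sum>ts\<in>forests_on k j (S - A). f (t # ts))"
proof -
  have inj: "inj_on (\<lambda>(A, t, ts). t # ts) (SIGMA A:Pow S. trees_on k A \<times> forests_on k j (S - A))"
    by (auto simp: inj_on_def trees_on_def)
  have fin: "finite (trees_on k A)" "finite (forests_on k j (S - A))" if "A \<in> Pow S" for A
    using that assms by (auto intro!: finite_forests_on finite_trees_on intro: finite_subset)
  have "sum f (forests_on k (Suc j) S)
    = (\<Sum>(A, t, ts)\<in>(SIGMA A:Pow S. trees_on k A \<times> forests_on k j (S - A)). f (t # ts))"
    unfolding forests_on_Suc sum.reindex[OF inj] by (intro sum.cong) auto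
  also have "\<dots> = (\<Sum>A\<in>Pow S. \<Sum>(t, ts)\<in>trees_on k A \<times> forests_on k j (S - A). f (t # ts))"
    using assms fin by (subst sum.Sigma) auto
  also have "\<dots> = (\<Sum>A\<in>Pow S. \<Sum>t\<in>trees_on k A. \<Sum>ts\<in>forests_on k j (S - A). f (t # ts))"
    using fin by (intro sum.cong refl) (simp add: sum.cartesian_product)
  finally show ?thesis .
qed

text \<open>The factors \<open>g\<close> and \<open>h\<close> may depend on \<open>A\<close>, so a
  weight may factor differently according to whether the smallest label lies in the first
  tree.\<close>

lemma sum_forests_on_Suc_mult:
  fixes g :: "nat set \<Rightarrow> ltree \<Rightarrow> 'a::comm_ring_1" and h :: "nat set \<Rightarrow> ltree list \<Rightarrow> 'a"
  assumes "finite S"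
    and "\<And>A t ts. A \<subseteq> S \<Longrightarrow> t \<in> trees_on k A \<Longrightarrow> ts \<in> forests_on k j (S - A) \<Longrightarrow>
      f (t # ts) = g A t * h A ts"
  shows "sum f (forests_on k (Suc j) S)
    = (\<Sum>A\<in>Pow S. sum (g A) (trees_on k A) * sum (h A) (forests_on k j (S - A)))"
  unfolding sum_forests_on_Suc[OF assms(1)] sum_product
  by (intro sum.cong refl) (use assms in auto)

text \<open>By the binomial-type property, a \<open>j\<close>-th power multiplies the last parameter
  by \<open>j\<close>.\<close>

lemma sum_forests_on_prod:
  fixes a b u :: "'a::comm_ring_1"
  assumes "finite S"
    and "\<And>A. A \<subseteq> S \<Longrightarrow> sum f (trees_on k A) = P (card A) a b u"
  shows "(\<Sum>ts\<in>forests_on k j S. prod_list (map f ts)) = P (card S) a b (of_nat j * u)"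
  using assms
proof (induction j arbitrary: S)
  case 0
  show ?case
  proof (cases "S = {}")
    \<comment> \<open>With \<open>j = 0\<close> the last parameter is 0, so \<open>P\<close>
      vanishes on nonempty label sets, in agreement with the empty set of forests.\<close>
    case False
    then obtain n where "card S = Suc n" using 0 by (metis card_0_eq not0_implies_Suc)
    then show ?thesis using False by (simp add: forests_on_0 P_Suc)
  qed (simp add: forests_on_0)
next
  case (Suc j)
  have "(\<Sum>ts\<in>forests_on k (Suc j) S. prod_list (map f ts))
    = (\<Sum>A\<in>Pow S. sum f (trees_on k A) * (\<Sum>ts\<in>forests_on k j (S - A). prod_list (map f ts)))"
    using Suc by (intro sum_forests_on_Suc_mult) auto
  also have "\<dots> = (\<Sum>A\<in>Pow S. P (card A) a b u * P (card (S - A)) a b (of_nat j * u))"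
    by (intro sum.cong refl arg_cong2[where f = "(*)"]) (use Suc in \<open>auto dest!: subset_DiffD\<close>)
  also have "\<dots> = P (card S) a b (u + of_nat j * u)"
    using Suc by (intro sum_Pow_P)
  finally show ?case by (simp add: algebra_simps)
qed

section \<open>Forests with one marked label\<close>

lemma sum_Pow_split:
  "finite S \<Longrightarrow> sum f (Pow S) = sum f {A\<in>Pow S. m \<in> A} + sum f {A\<in>Pow S. m \<notin> A}"
  by (subst sum.union_disjoint[symmetric]) (auto intro: sum.cong)

text \<open>This encodes the product rule: \<open>g\<close>, in the role of a derivative, is applied
  to the tree that carries the marked label \<open>m\<close>, and \<open>f\<close> to all
  others.\<close>

definition marked_prod :: "nat \<Rightarrow> (ltree \<Rightarrow> 'a) \<Rightarrow> (ltree \<Rightarrow> 'a) \<Rightarrow> ltree list \<Rightarrow> 'a::comm_ring_1" where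
  "marked_prod m f g ts = prod_list (map (\<lambda>t. if m \<in> set (labels t) then g t else f t) ts)"

lemma marked_prod_notin:
  "m \<notin> set (concat (map labels ts)) \<Longrightarrow> marked_prod m f g ts = prod_list (map f ts)"
  by (induction ts) (auto simp: marked_prod_def)

lemma marked_prod_Cons_in:
  assumes "distinct (concat (map labels (t # ts)))" "m \<in> set (labels t)"
  shows "marked_prod m f g (t # ts) = g t * prod_list (map f ts)"
proof -
  have "m \<notin> set (concat (map labels ts))" using assms by auto
  then show ?thesis using assms(2) marked_prod_notin[of m ts f g] by (simp add: marked_prod_def)
qed

lemma marked_prod_Cons_notin:
  "m \<notin> set (labels t) \<Longrightarrow> marked_prod m f g (t # ts) = f t * marked_prod m f g ts"
  by (simp add: marked_prod_def)

lemma forests_on_Cons_distinct: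
  "A \<subseteq> S \<Longrightarrow> t \<in> trees_on k A \<Longrightarrow> ts \<in> forests_on k j (S - A) \<Longrightarrow>
    distinct (concat (map labels (t # ts)))"
  by (auto simp: trees_on_def forests_on_def)

text \<open>Each of the \<open>j\<close> positions of the tree containing \<open>m\<close>
  contributes the same amount. In the induction the first position gives one such term, and the
  remaining \<open>j\<close> positions give \<open>j\<close> of them.\<close>

lemma sum_forests_on_marked_prod:
  fixes a b u :: "'a::comm_ring_1"
  assumes "finite S" "m \<in> S"
    and "\<And>A. A \<subseteq> S \<Longrightarrow> sum f (trees_on k A) = P (card A) a b u"
    and "\<And>A. A \<subseteq> S \<Longrightarrow> A \<noteq> {} \<Longrightarrow> sum g (trees_on k A) = P_quot (card A - 1) a b u"
  shows "(\<Sum>ts\<in>forests_on k j S. marked_prod m f g ts)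
    = of_nat j * P_quot (card S - 1) a b (of_nat j * u)"
  using assms
proof (induction j arbitrary: S)
  case 0
  then have "S \<noteq> {}" by auto
  then show ?case by (simp add: forests_on_0)
next
  case (Suc j)
  have "(\<Sum>ts\<in>forests_on k (Suc j) S. marked_prod m f g ts)
    = (\<Sum>A\<in>Pow S. sum (if m \<in> A then g else f) (trees_on k A) *
        sum (if m \<in> A then (\<lambda>ts. prod_list (map f ts)) else marked_prod m f g) (forests_on k j (S - A)))"
  proof (rule sum_forests_on_Suc_mult)
    fix A t ts assume *: "A \<subseteq> S" "t \<in> trees_on k A" "ts \<in> forests_on k j (S - A)"
    then have "A = set (labels t)" by (simp add: trees_on_def)
    then show "marked_prod m f g (t # ts) = (if m \<in> A then g else f) t *
        (if m \<in> A then (\<lambda>ts. prod_list (map f ts)) else marked_prod m f g) ts"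
      using forests_on_Cons_distinct[OF *] by (simp add: marked_prod_Cons_in marked_prod_Cons_notin)
  qed (use Suc in simp)
  also have "\<dots> = (\<Sum>A\<in>{A\<in>Pow S. m \<in> A}.
          P_quot (card A - 1) a b u * P (card (S - A)) a b (of_nat j * u))
      + (\<Sum>A\<in>{A\<in>Pow S. m \<notin> A}.
          P (card A) a b u * (of_nat j * P_quot (card (S - A) - 1) a b (of_nat j * u)))"
    unfolding sum_Pow_split[OF Suc.prems(1), of _ m]
  proof (intro arg_cong2[where f = "(+)"] sum.cong refl)
    fix A assume A: "A \<in> {A\<in>Pow S. m \<in> A}"
    have "(\<Sum>ts\<in>forests_on k j (S - A). prod_list (map f ts)) = P (card (S - A)) a b (of_nat j * u)"
      by (rule sum_forests_on_prod) (use Suc.prems in \<open>auto dest!: subset_DiffD\<close>)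
    moreover have "sum g (trees_on k A) = P_quot (card A - 1) a b u"
      using A Suc.prems(4) by auto
    ultimately show "sum (if m \<in> A then g else f) (trees_on k A) *
        sum (if m \<in> A then (\<lambda>ts. prod_list (map f ts)) else marked_prod m f g) (forests_on k j (S - A))
      = P_quot (card A - 1) a b u * P (card (S - A)) a b (of_nat j * u)"
      using A by simp
  next
    fix A assume A: "A \<in> {A\<in>Pow S. m \<notin> A}"
    have "sum (marked_prod m f g) (forests_on k j (S - A))
        = of_nat j * P_quot (card (S - A) - 1) a b (of_nat j * u)"
      by (rule Suc.IH) (use A Suc.prems in \<open>auto dest!: subset_DiffD\<close>)
    then show "sum (if m \<in> A then g else f) (trees_on k A) *
        sum (if m \<in> A then (\<lambda>ts. prod_list (map f ts)) else marked_prod m f g) (forests_on k j (S - A))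
      = P (card A) a b u * (of_nat j * P_quot (card (S - A) - 1) a b (of_nat j * u))"
      using A Suc.prems(3)[of A] by simp
  qed
  also have "\<dots> = P_quot (card S - 1) a b (u + of_nat j * u)
      + of_nat j * P_quot (card S - 1) a b (u + of_nat j * u)"
    unfolding mult.left_commute[of _ "of_nat j"] sum_distrib_left[symmetric]
    by (simp only: sum_Pow_mem_P[OF Suc.prems(1,2)])
  finally show ?case by (simp add: algebra_simps)
qed

section \<open>Weights\<close>

definition weight :: "'a \<Rightarrow> 'a \<Rightarrow> 'a \<Rightarrow> ltree \<Rightarrow> 'a::comm_ring_1" where
  "weight u v w T = v ^ (length (labels T) - prop_count T) * u ^ (prop_count T - comp_count T)
     * w ^ comp_count T"

text \<open>For trees other than \<open>Leaf\<close> this is \<open>weight\<close> with one factor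
  \<open>w\<close> cancelled, which makes sense even if \<open>w\<close> is not invertible.\<close>

definition weight_quot :: "'a \<Rightarrow> 'a \<Rightarrow> 'a \<Rightarrow> ltree \<Rightarrow> 'a::comm_ring_1" where
  "weight_quot u v w T = v ^ (length (labels T) - prop_count T) * u ^ (prop_count T - comp_count T)
     * w ^ (comp_count T - 1)"

lemma comp_count_pos: "T \<noteq> Leaf \<Longrightarrow> comp_count T > 0"
  by (cases T rule: decomposing_path.cases) (auto simp: comp_count_def)

lemma comp_count_le:
  "k > 1 \<Longrightarrow> kary k T \<Longrightarrow> distinct (labels T) \<Longrightarrow> comp_count T \<le> prop_count T"
  unfolding comp_count_def using comp_count_le_prop_count_aux by blast

lemma weight_Leaf [simp]: "weight u v w Leaf = 1"
  by (simp add: weight_def comp_count_def)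

lemma weight_eq_mult_weight_quot: "T \<noteq> Leaf \<Longrightarrow> weight u v w T = w * weight_quot u v w T"
  using comp_count_pos[of T] by (cases "comp_count T") (auto simp: weight_def weight_quot_def mult_ac)

text \<open>At \<open>w = u\<close> the path statistic cancels; this is the weight of the subtrees
  that the decomposing path does not enter.\<close>

lemma weight_diag:
  assumes "k > 1" "kary k T" "distinct (labels T)"
  shows "weight u v u T = v ^ (length (labels T) - prop_count T) * u ^ prop_count T"
  using comp_count_le[OF assms] by (simp add: weight_def mult.assoc flip: power_add)

lemma weight_quot_diag:
  assumes "k > 1" "kary k T" "distinct (labels T)" "T \<noteq> Leaf"
  shows "weight_quot u v u T = v ^ (length (labels T) - prop_count T) * u ^ (prop_count T - 1)"
  using comp_count_le[OF assms(1-3)] comp_count_pos[OF assms(4)]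
  by (simp add: weight_quot_def mult.assoc flip: power_add)

section \<open>Forest statistics and the weight of a tree in terms of its subtrees\<close>

abbreviation forest_labels :: "ltree list \<Rightarrow> nat list" where
  "forest_labels ts \<equiv> concat (map labels ts)"

abbreviation forest_prop :: "ltree list \<Rightarrow> nat" where
  "forest_prop ts \<equiv> sum_list (map prop_count ts)"

lemma forest_prop_le: "forest_prop ts \<le> length (forest_labels ts)"
  by (induction ts) (auto intro: add_mono prop_count_le_length)

lemma prod_weight_diag:
  assumes "k > 1" "list_all (kary k) ts" "distinct (forest_labels ts)"
  shows "prod_list (map (weight u v u) ts)
    = v ^ (length (forest_labels ts) - forest_prop ts) * u ^ forest_prop ts"
  using assms
proof (induction ts)
  case (Cons t ts)
  have "length (forest_labels (t # ts)) - forest_prop (t # ts)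
    = (length (labels t) - prop_count t) + (length (forest_labels ts) - forest_prop ts)"
    using forest_prop_le[of ts] prop_count_le_length[of t] by simp
  then show ?case
    using Cons weight_diag[of k t u v] by (simp add: power_add mult_ac)
qed simp

text \<open>The tree containing \<open>m\<close> has a proper vertex, so it can give up one factor
  \<open>u\<close>. This realises the division by \<open>u\<close> that an improper root
  causes.\<close>

lemma marked_prod_weight_diag:
  assumes "k > 1" "list_all (kary k) ts" "distinct (forest_labels ts)" "m \<in> set (forest_labels ts)"
  shows "forest_prop ts > 0 \<and> marked_prod m (weight u v u) (weight_quot u v u) ts
    = v ^ (length (forest_labels ts) - forest_prop ts) * u ^ (forest_prop ts - 1)"
  using assms
proof (induction ts)
  case (Cons t ts)
  have len: "length (forest_labels (t # ts)) - forest_prop (t # ts)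
    = (length (labels t) - prop_count t) + (length (forest_labels ts) - forest_prop ts)"
    using forest_prop_le[of ts] prop_count_le_length[of t] by simp
  show ?case
  proof (cases "m \<in> set (labels t)")
    case True
    then have "t \<noteq> Leaf" "labels t \<noteq> []" by auto
    then have pos: "prop_count t > 0" using prop_count_pos Cons.prems by auto
    then have *: "forest_prop (t # ts) - 1 = (prop_count t - 1) + forest_prop ts" by simp
    have "marked_prod m (weight u v u) (weight_quot u v u) (t # ts)
      = (v ^ (length (labels t) - prop_count t) * u ^ (prop_count t - 1)) *
        (v ^ (length (forest_labels ts) - forest_prop ts) * u ^ forest_prop ts)"
      unfolding marked_prod_Cons_in[OF Cons.prems(3) True]
      using Cons.prems \<open>t \<noteq> Leaf\<close> weight_quot_diag[of k t u v] prod_weight_diag[of k ts u v] by simp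
    then show ?thesis
      unfolding len * power_add using pos by (simp add: mult_ac)
  next
    case False
    then have IH: "forest_prop ts > 0" "marked_prod m (weight u v u) (weight_quot u v u) ts
      = v ^ (length (forest_labels ts) - forest_prop ts) * u ^ (forest_prop ts - 1)"
      using Cons by auto
    then have *: "forest_prop (t # ts) - 1 = prop_count t + (forest_prop ts - 1)" by simp
    have "marked_prod m (weight u v u) (weight_quot u v u) (t # ts)
      = (v ^ (length (labels t) - prop_count t) * u ^ prop_count t) *
        (v ^ (length (forest_labels ts) - forest_prop ts) * u ^ (forest_prop ts - 1))"
      unfolding marked_prod_Cons_notin[OF False] IH(2)
      using Cons.prems weight_diag[of k t u v] by simp
    then show ?thesis
      unfolding len * power_add using IH(1) by (simp add: mult_ac)
  qed
qed simp

text \<open>A proper root adds one to both \<open>prop_count\<close> and \<open>comp_count\<close>,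
  so the exponents of \<open>u\<close> and \<open>v\<close> see only the subtrees. The path
  continues into \<open>t\<close>, which therefore keeps the parameter \<open>w\<close>.\<close>

lemma weight_quot_proper:
  assumes k: "k > 1" and t: "kary k (Node x (t # t' # ts))" "distinct (labels (Node x (t # t' # ts)))"
    and x: "proper x (t # t' # ts)"
  shows "weight_quot u v w (Node x (t # t' # ts))
    = weight u v w t * prod_list (map (weight u v u) (t' # ts))"
proof -
  have c: "comp_count t \<le> prop_count t" using comp_count_le[OF k] t by auto
  have comp: "comp_count (Node x (t # t' # ts)) = Suc (comp_count t)"
    using x by (simp add: comp_count_def)
  have "length (labels (Node x (t # t' # ts))) - prop_count (Node x (t # t' # ts))
      = (length (labels t) - prop_count t) + (length (forest_labels (t' # ts)) - forest_prop (t' # ts))"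
    using forest_prop_le[of "t' # ts"] prop_count_le_length[of t] x by simp
  moreover have "prop_count (Node x (t # t' # ts)) - comp_count (Node x (t # t' # ts))
      = (prop_count t - comp_count t) + forest_prop (t' # ts)"
    using x c comp by simp
  moreover have "prod_list (map (weight u v u) (t' # ts))
      = v ^ (length (forest_labels (t' # ts)) - forest_prop (t' # ts)) * u ^ forest_prop (t' # ts)"
    by (rule prod_weight_diag[OF k]) (use t in auto)
  ultimately show ?thesis
    unfolding weight_quot_def weight_def by (simp only: comp power_add mult_ac diff_Suc_1)
qed

text \<open>An improper root lies on the path without being proper: it gives a factor
  \<open>v\<close> and costs a factor \<open>u\<close>. That \<open>u\<close> is taken from
  \<open>t\<close>, which contains \<open>m\<close>, while the path goes on into
  \<open>t'\<close>.\<close>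

lemma weight_quot_improper_in:
  assumes k: "k > 1" and t: "kary k (Node x (t # t' # ts))" "distinct (labels (Node x (t # t' # ts)))"
    and x: "\<not> proper x (t # t' # ts)"
    and m: "Min (set (labels (Node x (t # t' # ts)))) = m" "m \<in> set (labels t)"
  shows "weight_quot u v w (Node x (t # t' # ts))
    = weight_quot u v u t * (v * (weight u v w t' * prod_list (map (weight u v u) ts)))"
proof -
  have c: "comp_count t' \<le> prop_count t'" using comp_count_le[OF k] t by auto
  have nl: "t \<noteq> Leaf" "labels t \<noteq> []" using m by auto
  then have pos: "prop_count t > 0" using prop_count_pos t by auto
  have comp: "comp_count (Node x (t # t' # ts)) = Suc (comp_count t')"
    using x m by (simp add: comp_count_def del: labels.simps)
  have "length (labels (Node x (t # t' # ts))) - prop_count (Node x (t # t' # ts))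
      = Suc ((length (labels t) - prop_count t) + (length (labels t') - prop_count t')
         + (length (forest_labels ts) - forest_prop ts))"
    using forest_prop_le[of ts] prop_count_le_length[of t] prop_count_le_length[of t'] x by simp
  moreover have "prop_count (Node x (t # t' # ts)) - comp_count (Node x (t # t' # ts))
      = (prop_count t - 1) + (prop_count t' - comp_count t') + forest_prop ts"
    using x c comp pos by simp
  moreover have "prod_list (map (weight u v u) ts)
      = v ^ (length (forest_labels ts) - forest_prop ts) * u ^ forest_prop ts"
    by (rule prod_weight_diag[OF k]) (use t in auto)
  moreover have "weight_quot u v u t = v ^ (length (labels t) - prop_count t) * u ^ (prop_count t - 1)"
    by (rule weight_quot_diag[OF k]) (use t nl in auto)
  ultimately show ?thesis
    unfolding weight_quot_def[of u v w] weight_def[of u v w]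
    by (simp only: comp power_add power_Suc mult_ac diff_Suc_1)
qed

text \<open>Here the path enters \<open>t\<close>, and the missing factor \<open>u\<close> is taken
  from whichever later subtree contains \<open>m\<close>.\<close>

lemma weight_quot_improper_notin:
  assumes k: "k > 1" and t: "kary k (Node x (t # t' # ts))" "distinct (labels (Node x (t # t' # ts)))"
    and x: "\<not> proper x (t # t' # ts)"
    and m: "Min (set (labels (Node x (t # t' # ts)))) = m" "m \<notin> set (labels t)"
      "m \<in> set (forest_labels (t' # ts))"
  shows "weight_quot u v w (Node x (t # t' # ts))
    = weight u v w t * (v * marked_prod m (weight u v u) (weight_quot u v u) (t' # ts))"
proof -
  have c: "comp_count t \<le> prop_count t" using comp_count_le[OF k] t by auto
  have comp: "comp_count (Node x (t # t' # ts)) = Suc (comp_count t)"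
    using x m by (simp add: comp_count_def del: labels.simps)
  have "forest_prop (t' # ts) > 0 \<and> marked_prod m (weight u v u) (weight_quot u v u) (t' # ts)
      = v ^ (length (forest_labels (t' # ts)) - forest_prop (t' # ts)) * u ^ (forest_prop (t' # ts) - 1)"
    by (rule marked_prod_weight_diag[OF k]) (use t m in auto)
  moreover from this have "prop_count (Node x (t # t' # ts)) - comp_count (Node x (t # t' # ts))
      = (prop_count t - comp_count t) + (forest_prop (t' # ts) - 1)"
    using x c comp by auto
  moreover have "length (labels (Node x (t # t' # ts))) - prop_count (Node x (t # t' # ts))
      = Suc ((length (labels t) - prop_count t)
         + (length (forest_labels (t' # ts)) - forest_prop (t' # ts)))"
    using forest_prop_le[of "t' # ts"] prop_count_le_length[of t] x by simp
  ultimately show ?thesis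
    unfolding weight_quot_def[of u v w] weight_def[of u v w]
    by (simp only: comp power_add power_Suc mult_ac diff_Suc_1)
qed

section \<open>Decomposition at the smallest label\<close>

text \<open>This lets the main induction run on \<open>weight_quot\<close> alone; the empty label
  set contributes only \<open>Leaf\<close>, of weight 1.\<close>

lemma sum_weight_from_quot:
  assumes "finite A"
    and "A \<noteq> {} \<Longrightarrow> sum (weight_quot u v w) (trees_on k A) = P_quot (card A - 1) a b w"
  shows "sum (weight u v w) (trees_on k A) = P (card A) a b w"
proof (cases "A = {}")
  case False
  then obtain n where n: "card A = Suc n" using assms by (metis card_0_eq not0_implies_Suc)
  have "T \<noteq> Leaf" if "T \<in> trees_on k A" for T
    using that False by (auto simp: trees_on_def)
  then have "sum (weight u v w) (trees_on k A) = (\<Sum>T\<in>trees_on k A. w * weight_quot u v w T)"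
    by (intro sum.cong refl weight_eq_mult_weight_quot)
  then show ?thesis
    using assms(2)[OF False] by (simp add: n P_Suc flip: sum_distrib_left)
qed simp

lemma sum_forests_on_hd:
  fixes a b u w :: "'a::comm_ring_1"
  assumes "finite R"
    and "\<And>A. A \<subseteq> R \<Longrightarrow> sum f (trees_on k A) = P (card A) a b u"
    and "\<And>A. A \<subseteq> R \<Longrightarrow> sum g (trees_on k A) = P (card A) a b w"
  shows "(\<Sum>ts\<in>forests_on k (Suc j) R. g (hd ts) * prod_list (map f (tl ts)))
    = P (card R) a b (w + of_nat j * u)"
proof -
  have "(\<Sum>ts\<in>forests_on k (Suc j) R. g (hd ts) * prod_list (map f (tl ts)))
    = (\<Sum>A\<in>Pow R. sum g (trees_on k A) * (\<Sum>ts\<in>forests_on k j (R - A). prod_list (map f ts)))"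
    using assms by (intro sum_forests_on_Suc_mult) auto
  also have "\<dots> = (\<Sum>A\<in>Pow R. P (card A) a b w * P (card (R - A)) a b (of_nat j * u))"
    by (intro sum.cong refl arg_cong2[where f = "(*)"] sum_forests_on_prod)
       (use assms in \<open>auto dest!: subset_DiffD\<close>)
  also have "\<dots> = P (card R) a b (w + of_nat j * u)"
    using assms by (intro sum_Pow_P)
  finally show ?thesis .
qed

text \<open>The root is proper, so its subtrees contribute one factor at \<open>w\<close> and
  \<open>k - 1\<close> factors at \<open>u\<close>, and the parameters add.\<close>

lemma sum_root_min:
  fixes u v w :: "'a::comm_ring_1"
  assumes k: "k = Suc (Suc j)" and R: "finite R" and m: "\<And>y. y \<in> R \<Longrightarrow> m < y"
    and W: "\<And>A w. A \<subseteq> R \<Longrightarrow> sum (weight u v w) (trees_on k A) = P (card A) a b w"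
  shows "(\<Sum>ts\<in>forests_on k k R. weight_quot u v w (Node m ts))
    = P (card R) a b (w + of_nat (k - 1) * u)"
proof -
  have "(\<Sum>ts\<in>forests_on k k R. weight_quot u v w (Node m ts))
    = (\<Sum>ts\<in>forests_on k k R. weight u v w (hd ts) * prod_list (map (weight u v u) (tl ts)))"
  proof (intro sum.cong refl)
    fix l assume l: "l \<in> forests_on k k R"
    then obtain t t' ts where l': "l = t # t' # ts"
      using k by (auto simp: forests_on_def length_Suc_conv)
    have "weight_quot u v w (Node m (t # t' # ts))
      = weight u v w t * prod_list (map (weight u v u) (t' # ts))"
    proof (rule weight_quot_proper)
      show "kary k (Node m (t # t' # ts))"
        using l by (simp add: forests_on_def l')
      show "distinct (labels (Node m (t # t' # ts)))" "proper m (t # t' # ts)"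
        using l m by (fastforce simp: forests_on_def l' proper_def)+
    qed (simp add: k)
    then show "weight_quot u v w (Node m l)
      = weight u v w (hd l) * prod_list (map (weight u v u) (tl l))"
      by (simp add: l')
  qed
  also have "\<dots> = P (card R) a b (w + of_nat (Suc j) * u)"
    unfolding k by (rule sum_forests_on_hd) (use R W k in auto)
  finally show ?thesis by (simp add: k)
qed

text \<open>The root is improper, and \<open>m\<close> lies in one of the \<open>k\<close> subtrees.
  Each position of that subtree contributes the same term, although the path enters the second
  subtree when \<open>m\<close> is in the first.\<close>

lemma sum_root_not_min:
  fixes u v w :: "'a::comm_ring_1"
  assumes k: "k = Suc (Suc j)" and R: "finite R" "m \<in> R" "x \<notin> R" "m < x"
    and m: "\<And>y. y \<in> R \<Longrightarrow> m \<le> y"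
    and W: "\<And>A w. A \<subseteq> R \<Longrightarrow> sum (weight u v w) (trees_on k A) = P (card A) a b w"
    and Q: "\<And>A w. A \<subseteq> R \<Longrightarrow> A \<noteq> {} \<Longrightarrow>
      sum (weight_quot u v w) (trees_on k A) = P_quot (card A - 1) a b w"
  shows "(\<Sum>ts\<in>forests_on k k R. weight_quot u v w (Node x ts))
    = of_nat k * v * P_quot (card R - 1) a b (w + of_nat (k - 1) * u)"
proof -
  let ?f = "weight u v u" and ?g = "weight_quot u v u"
  \<comment> \<open>\<open>?h\<close> weighs the remaining \<open>k - 1\<close> subtrees: if
    \<open>m\<close> is in the first subtree, the path enters the head of this list, otherwise the
    list contains \<open>m\<close> and misses the path.\<close>
  let ?h = "\<lambda>A. if m \<in> A then (\<lambda>ts. weight u v w (hd ts) * prod_list (map ?f (tl ts)))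
      else marked_prod m ?f ?g"
  have "(\<Sum>ts\<in>forests_on k (Suc (Suc j)) R. weight_quot u v w (Node x ts))
    = (\<Sum>A\<in>Pow R. sum (if m \<in> A then ?g else weight u v w) (trees_on k A) *
        (\<Sum>ts\<in>forests_on k (Suc j) (R - A). v * ?h A ts))"
  proof (rule sum_forests_on_Suc_mult)
    fix A t l assume *: "A \<subseteq> R" "t \<in> trees_on k A" "l \<in> forests_on k (Suc j) (R - A)"
    then obtain t' ts where l: "l = t' # ts"
      by (auto simp: forests_on_def length_Suc_conv)
    have A: "A = set (labels t)" using * by (simp add: trees_on_def)
    have k1: "k > 1" by (simp add: k)
    have kary: "kary k (Node x (t # t' # ts))"
      using * by (simp add: forests_on_def trees_on_def l k)
    have RA: "set (forest_labels (t # t' # ts)) = R" "set (forest_labels (t' # ts)) = R - A"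
      using * by (auto simp: forests_on_def trees_on_def l)
    have dist: "distinct (labels (Node x (t # t' # ts)))"
      using forests_on_Cons_distinct[OF *] R(3) RA(1) unfolding l by simp
    have improper: "\<not> proper x (t # t' # ts)"
    proof -
      obtain s where "s \<in> set (t # t' # ts)" "m \<in> set (labels s)"
        using R(2) RA(1) by auto
      then show ?thesis using R(4) unfolding proper_def by (meson less_asym)
    qed
    have "set (labels (Node x (t # t' # ts))) = insert x R"
      using RA(1) by simp
    then have Min: "Min (set (labels (Node x (t # t' # ts)))) = m"
      using R m by (auto intro!: Min_eqI)
    show "weight_quot u v w (Node x (t # l))
      = (if m \<in> A then ?g else weight u v w) t * (v * ?h A l)"
    proof (cases "m \<in> A")
      case True
      then show ?thesis
        using weight_quot_improper_in[OF k1 kary dist improper Min] A by (simp add: l)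
    next
      case False
      then have "m \<notin> set (labels t)" "m \<in> set (forest_labels (t' # ts))"
        using A RA(2) R(2) by auto
      from weight_quot_improper_notin[OF k1 kary dist improper Min this] show ?thesis
        using False by (simp add: l)
    qed
  qed (use R in simp)
  also have "\<dots> = (\<Sum>A\<in>{A\<in>Pow R. m \<in> A}.
          v * (P_quot (card A - 1) a b u * P (card (R - A)) a b (w + of_nat j * u)))
      + (\<Sum>A\<in>{A\<in>Pow R. m \<notin> A}. v * of_nat (Suc j) *
          (P (card A) a b w * P_quot (card (R - A) - 1) a b (of_nat (Suc j) * u)))"
    unfolding sum_Pow_split[OF R(1), of _ m]
  proof (intro arg_cong2[where f = "(+)"] sum.cong refl)
    fix A assume A: "A \<in> {A\<in>Pow R. m \<in> A}"
    have "sum (?h A) (forests_on k (Suc j) (R - A)) = P (card (R - A)) a b (w + of_nat j * u)"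
      using A R W sum_forests_on_hd[of "R - A" ?f k a b u "weight u v w" w j]
      by (simp add: subset_iff)
    moreover have "sum ?g (trees_on k A) = P_quot (card A - 1) a b u"
      using A Q by auto
    ultimately show "sum (if m \<in> A then ?g else weight u v w) (trees_on k A) *
        (\<Sum>ts\<in>forests_on k (Suc j) (R - A). v * ?h A ts)
      = v * (P_quot (card A - 1) a b u * P (card (R - A)) a b (w + of_nat j * u))"
      using A by (simp add: mult_ac flip: sum_distrib_left)
  next
    fix A assume A: "A \<in> {A\<in>Pow R. m \<notin> A}"
    have "sum (marked_prod m ?f ?g) (forests_on k (Suc j) (R - A))
        = of_nat (Suc j) * P_quot (card (R - A) - 1) a b (of_nat (Suc j) * u)"
      by (rule sum_forests_on_marked_prod) (use A R W Q in \<open>auto dest!: subset_DiffD\<close>)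
    then show "sum (if m \<in> A then ?g else weight u v w) (trees_on k A) *
        (\<Sum>ts\<in>forests_on k (Suc j) (R - A). v * ?h A ts)
      = v * of_nat (Suc j) *
          (P (card A) a b w * P_quot (card (R - A) - 1) a b (of_nat (Suc j) * u))"
      using A W[of A w] by (simp add: mult_ac del: of_nat_Suc flip: sum_distrib_left)
  qed
  \<comment> \<open>Both last arguments equal \<open>w + of_nat (k - 1) * u\<close>, and the
    multiplicities 1 and \<open>Suc j\<close> add up to \<open>k\<close>.\<close>
  also have "\<dots> = v * P_quot (card R - 1) a b (u + (w + of_nat j * u))
      + v * of_nat (Suc j) * P_quot (card R - 1) a b (w + of_nat (Suc j) * u)"
    unfolding sum_distrib_left[symmetric] by (simp only: sum_Pow_mem_P[OF R(1,2)])
  finally show ?thesis by (simp add: k algebra_simps)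
qed

text \<open>Induction on the size of \<open>S\<close> with \<open>w\<close> arbitrary, since the
  subtrees off the path are needed at \<open>w = u\<close>. Sorting trees by whether the root is the
  smallest label reproduces the two summands of \<open>P_quot_rec\<close>.\<close>

lemma sum_weight_quot:
  fixes u v w :: "'a::comm_ring_1"
  assumes "k > 1" "finite S" "S \<noteq> {}"
  shows "sum (weight_quot u v w) (trees_on k S)
    = P_quot (card S - 1) (of_nat k * v) (of_nat (k - 1) * u) w"
  using assms(2,3)
proof (induction "card S" arbitrary: S w rule: less_induct)
  case less
  let ?a = "of_nat k * v" and ?b = "of_nat (k - 1) * u"
  obtain j where k: "k = Suc (Suc j)"
    by (rule that[of "k - 2"]) (use assms(1) in linarith)
  define m where "m = Min S"
  have m: "m \<in> S" "\<And>y. y \<in> S \<Longrightarrow> m \<le> y"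
    using less.prems by (auto simp: m_def)
  have fin: "finite A" if "A \<subseteq> S" for A
    using that less.prems finite_subset by blast
  have Q: "sum (weight_quot u v w) (trees_on k A) = P_quot (card A - 1) ?a ?b w"
    if "A \<subseteq> S - {x}" "x \<in> S" "A \<noteq> {}" for A x w
  proof (rule less.hyps)
    have "A \<subset> S" using that by auto
    then show "card A < card S" using less.prems psubset_card_mono by blast
  qed (use that fin in auto)
  have W: "sum (weight u v w) (trees_on k A) = P (card A) ?a ?b w"
    if "A \<subseteq> S - {x}" "x \<in> S" for A x w
    by (rule sum_weight_from_quot[OF fin[OF subset_DiffD[OF that(1)]] Q[OF that]])
  have "sum (weight_quot u v w) (trees_on k S)
    = (\<Sum>ts\<in>forests_on k k (S - {m}). weight_quot u v w (Node m ts)) +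
      (\<Sum>x\<in>S - {m}. \<Sum>ts\<in>forests_on k k (S - {x}). weight_quot u v w (Node x ts))"
    unfolding sum_trees_on[OF less.prems] by (rule sum.remove[OF less.prems(1) m(1)])
  also have "(\<Sum>ts\<in>forests_on k k (S - {m}). weight_quot u v w (Node m ts))
    = P (card (S - {m})) ?a ?b (w + ?b)"
  proof (rule sum_root_min[OF k])
    show "m < y" if "y \<in> S - {m}" for y using m(2)[of y] that by auto
  qed (use W m less.prems in auto)
  also have "(\<Sum>x\<in>S - {m}. \<Sum>ts\<in>forests_on k k (S - {x}). weight_quot u v w (Node x ts))
    = (\<Sum>x\<in>S - {m}. ?a * P_quot (card (S - {x}) - 1) ?a ?b (w + ?b))"
  proof (intro sum.cong refl)
    fix x assume x: "x \<in> S - {m}"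
    show "(\<Sum>ts\<in>forests_on k k (S - {x}). weight_quot u v w (Node x ts))
      = ?a * P_quot (card (S - {x}) - 1) ?a ?b (w + ?b)"
    proof (rule sum_root_not_min[OF k])
      show "m < x" using m(2)[of x] x by auto
    qed (use W Q m x less.prems in auto)
  qed
  also have "\<dots> = (\<Sum>x\<in>S - {m}. ?a * P_quot (card S - 1 - 1) ?a ?b (w + ?b))"
    using less.prems by (intro sum.cong refl) simp
  \<comment> \<open>There are \<open>card S - 1\<close> choices of a nonminimal root, which gives
    the factor \<open>of_nat n\<close> of the recursion; \<open>?b\<close> is its shift of the last
    parameter.\<close>
  also have "P (card (S - {m})) ?a ?b (w + ?b) + \<dots> = P_quot (card S - 1) ?a ?b w"
    using m less.prems by (subst P_quot_rec[of "card S - 1"]) (simp add: mult.assoc)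
  finally show ?case .
qed

theorem theorem7p3:
  fixes k n :: nat and u v w :: "'a::comm_ring_1"
  assumes "k > 1"
  shows "(\<Sum>T \<in> labeled_trees k n.
            v ^ (n - prop_count T) * u ^ (prop_count T - comp_count T) * w ^ comp_count T)
         = P n (of_nat k * v) (of_nat (k - 1) * u) w"
proof -
  have "length (labels T) = n" if "T \<in> labeled_trees k n" for T
    using that distinct_card[of "labels T"] by (simp add: labeled_trees_def)
  then have "(\<Sum>T \<in> labeled_trees k n.
      v ^ (n - prop_count T) * u ^ (prop_count T - comp_count T) * w ^ comp_count T)
    = sum (weight u v w) (trees_on k {1..n})"
    by (intro sum.cong) (auto simp: weight_def labeled_trees_def trees_on_def)
  \<comment> \<open>The case \<open>n = 0\<close> is the empty label set, covered by
    \<open>sum_weight_from_quot\<close>.\<close>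
  also have "\<dots> = P (card {1..n}) (of_nat k * v) (of_nat (k - 1) * u) w"
    by (intro sum_weight_from_quot sum_weight_quot assms) auto
  finally show ?thesis by simp
qed

end
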